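(* Let $d \geq 2$ be an integer, $\theta \in (0,\pi/2]$ and $0 \leq r \leq r_{1,d}(\theta)$, where $$ r_{1,d}(\theta) = \begin{cases} \dfrac{\tan(2\theta/d)}{\sin\theta} & \text{if } \theta \leq \theta_d,\\[2mm] \dfrac{\tan((\theta + \beta^* )/d)}{\sin\theta} & \text{if } \theta > \theta_d. \end{cases} $$ If $\lambda = r\exp(\iota\theta)$, then $Z_G(\lambda) \neq 0$ for every graph $G$ of maximum degree at most $d+1$.
   Context: For a finite graph $G$, $Z_G(\lambda) = \sum_{I} \lambda^{|I|}$, the sum over all independent sets $I$ of $G$ (including the empty set); $\iota$ is the imaginary unit. $\theta_d \in (\pi/(2(d+1)), \pi/2)$ is the unique solution $x$ in that interval of $\tan(2x/d) = \dfrac{\tan((\pi/2 - x)/d)}{1 - \frac{\tan((\pi/2-x)/d)}{\tan x}}$. For $\theta \in [\theta_d, \pi/2)$, $\beta^* \in (0,\theta)$ is defined as the unique solution $x$ of $\dfrac{\tan((\theta+x)/d)}{\sin\theta} = \dfrac{\tan((\pi/2-\theta)/d)}{\sin x - \cos x \tan((\pi/2-\theta)/d)}$; for $\theta = \pi/2$, $\beta^* := 0$. *)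

theory Defs
  imports Complex_Main "HOL-Library.Ramsey"
begin

text \<open>
  A finite simple graph is given by its vertex set and its set of edges, the edges being
  two-element sets of vertices (\<^const>\<open>nsets\<close> of size 2).
\<close>

definition simple_graph :: "'a set \<Rightarrow> 'a set set \<Rightarrow> bool" where
  "simple_graph V E \<longleftrightarrow> finite V \<and> E \<subseteq> nsets V 2"

definition degree :: "'a set set \<Rightarrow> 'a \<Rightarrow> nat" where
  "degree E v = card {e \<in> E. v \<in> e}"

text \<open>
  Stated vertexwise because the maximum degree of the graph without vertices would be the
  unspecified value \<^term>\<open>Max {}\<close>.
\<close>

definition max_degree_le :: "'a set \<Rightarrow> 'a set set \<Rightarrow> nat \<Rightarrow> bool" where
  "max_degree_le V E k \<longleftrightarrow> (\<forall>v\<in>V. degree E v \<le> k)"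

definition indep_poly :: "'a set \<Rightarrow> 'a set set \<Rightarrow> complex \<Rightarrow> complex" where
  "indep_poly V E z = (\<Sum>I | I \<subseteq> V \<and> indep I E. z ^ card I)"

text \<open>
  Division by zero does not add solutions to the two equations below.  In the first one both
  \<open>tan x\<close> and the denominator \<open>1 - tan ((pi/2 - x)/d) / tan x\<close> are nonzero on the given interval;
  the denominator vanishes at its excluded left end point.  In the second one the denominator
  on the right vanishes only at \<open>x = (pi/2 - \<theta>)/d\<close>, where the left-hand side is positive.
\<close>

definition theta_crit :: "nat \<Rightarrow> real" where
  "theta_crit d = (THE x. pi / (2 * (real d + 1)) < x \<and> x < pi / 2 \<and>
     tan (2 * x / real d) =
       tan ((pi / 2 - x) / real d) / (1 - tan ((pi / 2 - x) / real d) / tan x))"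

text \<open>
  At \<open>\<theta> = theta_crit d\<close> the root of this equation is \<open>x = \<theta>\<close>, outside the open interval, so
  \<open>beta_star\<close> carries information only for \<open>theta_crit d < \<theta> \<le> pi/2\<close>.
  This is the range in which \<open>r1\<close> uses it.
\<close>

definition beta_star :: "nat \<Rightarrow> real \<Rightarrow> real" where
  "beta_star d \<theta> =
     (if \<theta> = pi / 2 then 0
      else (THE x. 0 < x \<and> x < \<theta> \<and>
        tan ((\<theta> + x) / real d) / sin \<theta> =
          tan ((pi / 2 - \<theta>) / real d) /
            (sin x - cos x * tan ((pi / 2 - \<theta>) / real d))))"

definition r1 :: "nat \<Rightarrow> real \<Rightarrow> real" where
  "r1 d \<theta> =
     (if \<theta> \<le> theta_crit d then tan (2 * \<theta> / real d) / sin \<theta>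
      else tan ((\<theta> + beta_star d \<theta>) / real d) / sin \<theta>)"

end

(*
  Write a ratio of independence polynomials Z(U + v) / Z(U) as w = rho * cis phi.  If v has at
  most d neighbours in U then w = 1 + z / P, where P is a product of at most d such ratios.  With
  b = (pi/2 - theta) / d and a = (theta + beta) / d, where beta is theta or beta_star, the region
  - b <= phi <= a, rho >= 1, rho >= exp (- phi * cot theta) is preserved: its last two conditions
  are multiplicative, the bounds on phi confine the argument of z / P to [- beta, pi/2], and the
  exponential bound, which stands in for the log-convexity of the boundary of the region, controls
  the modulus of z / P when that argument exceeds theta.  At a vertex with d + 1 neighbours,
  vanishing would give w' = - z / P with Re w' > 0 and Re (z / P) >= 0.
*)

theory Submission
  imports Defs
begin

section \<open>An invariant region\<close>

lemma cos_mult_le_sin: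
  fixes c :: real
  assumes "0 \<le> c" "c \<le> pi"
  shows "c * cos c \<le> sin c"
proof -
  have "(\<lambda>x. sin x - x * cos x) 0 \<le> (\<lambda>x. sin x - x * cos x) c"
  proof (rule DERIV_nonneg_imp_nondecreasing [OF assms(1)])
    fix x assume x: "0 \<le> x" "x \<le> c"
    have "((\<lambda>x. sin x - x * cos x) has_real_derivative x * sin x) (at x)"
      by (auto intro!: derivative_eq_intros)
    moreover have "0 \<le> x * sin x" using x assms by (simp add: sin_ge_zero)
    ultimately show "\<exists>y. ((\<lambda>x. sin x - x * cos x) has_real_derivative y) (at x) \<and> 0 \<le> y"
      by blast
  qed
  then show ?thesis by simp
qed

text \<open>The line \<open>x + t * y = 1\<close> is tangent at 1 to the logarithmic spiral of
  modulus \<open>exp (- t * \<phi>)\<close> at angle \<open>\<phi>\<close>. At angle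
  \<open>- p\<close> it has modulus \<open>1 / (cos p - t * sin p)\<close> wherever that denominator
  is positive, so the estimate keeps it outside the spiral.\<close>

lemma exp_mult_cos_minus_sin_le:
  fixes t p :: real
  assumes "0 \<le> p" "p \<le> pi"
  shows "exp (t * p) * (cos p - t * sin p) \<le> 1"
proof -
  let ?f = "\<lambda>x. exp (t * x) * (cos x - t * sin x)"
  have "?f p \<le> ?f 0"
  proof (rule DERIV_nonpos_imp_nonincreasing [OF assms(1)])
    fix x assume x: "0 \<le> x" "x \<le> p"
    have "(?f has_real_derivative - (exp (t * x) * (1 + t\<^sup>2) * sin x)) (at x)"
      by (auto intro!: derivative_eq_intros simp: algebra_simps power2_eq_square)
    moreover have "- (exp (t * x) * (1 + t\<^sup>2) * sin x) \<le> 0"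
      using x assms by (simp add: sin_ge_zero)
    ultimately show "\<exists>y. (?f has_real_derivative y) (at x) \<and> y \<le> 0" by blast
  qed
  then show ?thesis by simp
qed

text \<open>Expand the sine to first order in \<open>u\<close> and compare with
  \<open>1 + cot \<theta> * u\<close>. The leftover \<open>u * sin \<theta> * sin a\<close> is
  absorbed by the gap \<open>cos \<theta> * sin a\<close> between \<open>sin (\<theta> - a)\<close>
  and \<open>sin \<theta> * cos a\<close>.\<close>

lemma sin_shift_le_exp:
  fixes \<theta> a u :: real
  assumes "0 < \<theta>" "0 \<le> a" "a \<le> \<theta>" "a < pi / 2" "0 \<le> u" "u \<le> pi / 2 - \<theta>"
  shows "sin (\<theta> + u - a) \<le> exp (cot \<theta> * u) * (sin \<theta> * cos a)"
proof -
  have s: "0 < sin \<theta>" using assms by (intro sin_gt_zero) auto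
  have ca: "0 \<le> cos a" using assms by (intro cos_ge_zero) auto
  have "(pi / 2 - \<theta>) * sin \<theta> \<le> cos \<theta>"
    using cos_mult_le_sin [of "pi / 2 - \<theta>"] assms by (simp add: cos_diff sin_diff)
  moreover have "u * sin \<theta> \<le> (pi / 2 - \<theta>) * sin \<theta>" using assms s by simp
  ultimately have "u * sin \<theta> \<le> cos \<theta>" by linarith
  then have key: "u * sin \<theta> * sin a \<le> cos \<theta> * sin a"
    using assms by (intro mult_right_mono sin_ge_zero) auto
  have "sin (\<theta> + u - a) = sin (\<theta> - a) * cos u + cos (\<theta> - a) * sin u"
    using sin_add [of "\<theta> - a" u] by (simp add: algebra_simps)
  also have "\<dots> \<le> sin (\<theta> - a) * 1 + cos (\<theta> - a) * u"
    using assms by (intro add_mono mult_left_mono sin_x_le_x sin_ge_zero cos_ge_zero) auto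
  also have "\<dots> \<le> sin \<theta> * cos a + u * cos \<theta> * cos a"
    using key by (simp add: sin_diff cos_diff algebra_simps)
  also have "\<dots> = (1 + cot \<theta> * u) * (sin \<theta> * cos a)"
    using s by (simp add: cot_def field_simps)
  also have "\<dots> \<le> exp (cot \<theta> * u) * (sin \<theta> * cos a)"
    using s ca by (intro mult_right_mono exp_ge_add_one_self) auto
  finally show ?thesis .
qed

section \<open>The region and its multiplicative structure\<close>

text \<open>Polar parameters are quantified instead of taken from \<open>Arg\<close>, so angles add
  under multiplication with no reduction modulo \<open>2 * pi\<close>.\<close>

definition region :: "real \<Rightarrow> real \<Rightarrow> real \<Rightarrow> complex set" where
  "region t a b = {complex_of_real \<rho> * cis \<phi> |\<rho> \<phi>. - b \<le> \<phi> \<and> \<phi> \<le> a \<and> 1 \<le> \<rho> \<and> exp (- t * \<phi>) \<le> \<rho>}"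

lemma one_in_region: "1 \<in> region t 0 0"
  unfolding region_def by (rule CollectI, rule exI [of _ 1], rule exI [of _ 0]) simp

lemma region_mono: "a \<le> a' \<Longrightarrow> b \<le> b' \<Longrightarrow> region t a b \<subseteq> region t a' b'"
  unfolding region_def by fastforce

text \<open>In the coordinates \<open>(\<phi>, ln \<rho>)\<close> multiplication is addition and the
  two modulus conditions define a convex cone; only the angular interval widens.\<close>

lemma region_mult:
  assumes "x \<in> region t a b" "y \<in> region t a' b'"
  shows "x * y \<in> region t (a + a') (b + b')"
proof -
  obtain \<rho> \<phi> where x: "x = complex_of_real \<rho> * cis \<phi>"
    "- b \<le> \<phi>" "\<phi> \<le> a" "1 \<le> \<rho>" "exp (- t * \<phi>) \<le> \<rho>"
    using assms(1) by (auto simp: region_def)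
  obtain \<rho>' \<phi>' where y: "y = complex_of_real \<rho>' * cis \<phi>'"
    "- b' \<le> \<phi>'" "\<phi>' \<le> a'" "1 \<le> \<rho>'" "exp (- t * \<phi>') \<le> \<rho>'"
    using assms(2) by (auto simp: region_def)
  have "x * y = complex_of_real (\<rho> * \<rho>') * cis (\<phi> + \<phi>')"
    by (simp add: x y cis_mult [symmetric] algebra_simps)
  moreover have "1 \<le> \<rho> * \<rho>'"
    using mult_mono [of 1 \<rho> 1 \<rho>'] x y by simp
  moreover have "exp (- t * (\<phi> + \<phi>')) \<le> \<rho> * \<rho>'"
    using mult_mono [of "exp (- t * \<phi>)" \<rho> "exp (- t * \<phi>')" \<rho>'] x y
    by (simp add: exp_add [symmetric] algebra_simps)
  ultimately show ?thesis
    unfolding region_def using x y by (intro CollectI exI [of _ "\<rho> * \<rho>'"] exI [of _ "\<phi> + \<phi>'"]) auto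
qed

lemma region_Re_pos:
  assumes "w \<in> region t a b" "a < pi / 2" "b < pi / 2"
  shows "0 < Re w"
proof -
  obtain \<rho> \<phi> where w: "w = complex_of_real \<rho> * cis \<phi>" "- b \<le> \<phi>" "\<phi> \<le> a" "1 \<le> \<rho>"
    using assms(1) by (auto simp: region_def)
  then have "0 < cos \<phi>" using assms by (intro cos_gt_zero_pi) auto
  then show ?thesis using w by simp
qed

lemma polar_right_half_plane:
  assumes "0 < Re w"
  obtains \<rho> \<phi> where "w = complex_of_real \<rho> * cis \<phi>" "- (pi / 2) < \<phi>" "\<phi> < pi / 2"
    "Re w = \<rho> * cos \<phi>" "Im w = \<rho> * sin \<phi>" "0 < \<rho>"
proof
  let ?\<phi> = "arctan (Im w / Re w)" and ?\<rho> = "Re w / cos (arctan (Im w / Re w))"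
  show l: "- (pi / 2) < ?\<phi>" and u: "?\<phi> < pi / 2"
    using arctan_lbound arctan_ubound by auto
  have c: "0 < cos ?\<phi>" using l u by (intro cos_gt_zero_pi) auto
  show re: "Re w = ?\<rho> * cos ?\<phi>" using c by simp
  have "tan ?\<phi> = Im w / Re w" by (rule tan_arctan)
  then show im: "Im w = ?\<rho> * sin ?\<phi>"
    using assms c by (simp add: tan_def field_simps)
  show "0 < ?\<rho>" using assms c by simp
  show "w = complex_of_real ?\<rho> * cis ?\<phi>"
    using re im by (intro complex_eqI) auto
qed

section \<open>The one-step estimate\<close>

text \<open>
  The condition \<open>r * (sin \<theta> * cos a) \<le> sin a\<close> is \<open>r \<le> tan a / sin \<theta>\<close>, and
  \<open>r * sin (\<beta> - b) \<le> sin b\<close> says that \<open>1 + r * cis (- \<beta>)\<close> has argument at least \<open>- b\<close>.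
\<close>

locale admissible =
  fixes d \<theta> \<beta> a b r :: real
  assumes \<theta>: "0 < \<theta>" "\<theta> \<le> pi / 2"
    and \<beta>: "0 \<le> \<beta>" "\<beta> \<le> \<theta>"
    and a: "0 \<le> a" "a \<le> \<theta>" "a < pi / 2" "d * a = \<theta> + \<beta>"
    and b: "0 \<le> b" "b < pi / 2" "d * b = pi / 2 - \<theta>"
    and r: "0 \<le> r" "r * (sin \<theta> * cos a) \<le> sin a" "r * sin (\<beta> - b) \<le> sin b"
begin

text \<open>\<open>P\<close> stands for a product of \<open>d\<close> ratios. Since
  \<open>d * b = pi / 2 - \<theta>\<close> and \<open>d * a = \<theta> + \<beta>\<close>, the angle
  \<open>\<psi>\<close> of \<open>R\<close> lies between \<open>- \<beta>\<close> and
  \<open>pi / 2\<close>, and its modulus \<open>q\<close> is at most \<open>r\<close>.\<close>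

lemma ratio_in_region:
  assumes "P \<in> region (cot \<theta>) (d * a) (d * b)"
  defines "R \<equiv> complex_of_real r * cis \<theta> / P"
  shows "0 \<le> Re R" and "1 + R \<in> region (cot \<theta>) a b"
proof -
  obtain \<sigma> \<Phi> where P: "P = complex_of_real \<sigma> * cis \<Phi>" "- (pi / 2 - \<theta>) \<le> \<Phi>" "\<Phi> \<le> \<theta> + \<beta>"
    "1 \<le> \<sigma>" "exp (- cot \<theta> * \<Phi>) \<le> \<sigma>"
    using assms(1) unfolding region_def a b by auto
  define q \<psi> where "q = r / \<sigma>" and "\<psi> = \<theta> - \<Phi>"
  have R: "R = complex_of_real q * cis \<psi>"
    by (simp add: R_def P q_def \<psi>_def cis_divide [symmetric])
  have q: "0 \<le> q" "q \<le> r"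
    using P r divide_left_mono [of 1 \<sigma> r] by (auto simp: q_def)
  have \<psi>: "- \<beta> \<le> \<psi>" "\<psi> \<le> pi / 2" using P by (auto simp: \<psi>_def)
  have cpsi: "0 \<le> cos \<psi>" using \<psi> \<beta> \<theta> by (intro cos_ge_zero) auto
  then show "0 \<le> Re R" using q by (simp add: R)
  then have "0 < Re (1 + R)" by simp
  then obtain \<rho> \<phi> where w: "1 + R = complex_of_real \<rho> * cis \<phi>" "- (pi / 2) < \<phi>" "\<phi> < pi / 2"
    "1 + q * cos \<psi> = \<rho> * cos \<phi>" "q * sin \<psi> = \<rho> * sin \<phi>" "0 < \<rho>"
  proof (rule polar_right_half_plane)
    fix \<rho> \<phi>
    assume "1 + R = complex_of_real \<rho> * cis \<phi>" "- (pi / 2) < \<phi>" "\<phi> < pi / 2"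
      "Re (1 + R) = \<rho> * cos \<phi>" "Im (1 + R) = \<rho> * sin \<phi>" "0 < \<rho>"
    moreover have "Re (1 + R) = 1 + q * cos \<psi>" "Im (1 + R) = q * sin \<psi>" by (simp_all add: R)
    ultimately show thesis by (intro that [of \<rho> \<phi>]) argo+
  qed
  have s\<theta>: "0 < sin \<theta>" using \<theta> by (intro sin_gt_zero) auto
  have "1 \<le> \<rho> * cos \<phi>" using w(4) q cpsi by (metis le_add_same_cancel1 mult_nonneg_nonneg)
  also have "\<dots> \<le> \<rho>" using w by simp
  finally have \<rho>: "1 \<le> \<rho>" .
  have "\<phi> \<le> a"
  proof (rule ccontr)
    assume "\<not> \<phi> \<le> a"
    \<comment> \<open>This is the imaginary part of \<open>(1 + R) * cis (- a)\<close>. Computed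
      from \<open>q\<close> and \<open>\<psi>\<close>, it reduces the claim to
      \<open>q * sin (\<psi> - a) \<le> sin a\<close>.\<close>
    then have "0 < \<rho> * sin (\<phi> - a)" using a w by (intro mult_pos_pos sin_gt_zero) auto
    also have "\<rho> * sin (\<phi> - a) = (\<rho> * sin \<phi>) * cos a - (\<rho> * cos \<phi>) * sin a"
      by (simp add: sin_diff algebra_simps)
    also have "\<dots> = q * sin (\<psi> - a) - sin a"
      unfolding w(4) [symmetric] w(5) [symmetric] by (simp add: sin_diff algebra_simps)
    finally have gt: "sin a < q * sin (\<psi> - a)" by simp
    have sa: "0 \<le> sin a" using a by (intro sin_ge_zero) auto
    consider "\<psi> \<le> a" | "a < \<psi>" "\<psi> \<le> \<theta>" | "a < \<psi>" "\<theta> < \<psi>" by linarith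
    then show False
    proof cases
      case 1
      then have "0 \<le> sin (a - \<psi>)" using \<psi> \<beta> \<theta> a by (intro sin_ge_zero) auto
      then have "q * sin (\<psi> - a) \<le> 0"
        using q sin_minus [of "a - \<psi>"] by (simp add: mult_nonneg_nonpos)
      then show False using gt sa by linarith
    next
      case 2
      have "q * sin (\<psi> - a) \<le> r * sin (\<theta> - a)"
        using 2 \<psi> q \<theta> a r by (intro mult_mono sin_ge_zero sin_monotone_2pi_le) auto
      also have "\<dots> \<le> r * (sin \<theta> * cos a)"
        using a \<theta> r sa by (intro mult_left_mono) (auto simp: sin_diff cos_ge_zero)
      finally show False using gt r by linarith
    next
      case 3
      \<comment> \<open>Here \<open>\<Phi> = - (\<psi> - \<theta>)\<close> is negative, so the
        exponential lower bound on \<open>\<sigma>\<close> becomes a decay of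
        \<open>q = r / \<sigma>\<close> that offsets the growth of the sine beyond
        \<open>\<theta>\<close>.\<close>
      have qe: "q \<le> r * exp (- (cot \<theta> * (\<psi> - \<theta>)))"
      proof -
        have "r = r * exp (- (cot \<theta> * (\<psi> - \<theta>))) * exp (- cot \<theta> * \<Phi>)"
          by (simp add: \<psi>_def mult.assoc flip: exp_add)
        also have "\<dots> \<le> r * exp (- (cot \<theta> * (\<psi> - \<theta>))) * \<sigma>"
          using P r by (intro mult_left_mono) auto
        finally show ?thesis using P by (simp add: q_def field_simps)
      qed
      have "q * sin (\<psi> - a) \<le> r * exp (- (cot \<theta> * (\<psi> - \<theta>))) * (exp (cot \<theta> * (\<psi> - \<theta>)) * (sin \<theta> * cos a))"
        using 3 \<psi> q \<theta> a r qe sin_shift_le_exp [of \<theta> a "\<psi> - \<theta>"]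
        by (intro mult_mono sin_ge_zero) auto
      also have "\<dots> = r * (sin \<theta> * cos a)"
        by (simp add: exp_minus)
      finally show False using gt r by linarith
    qed
  qed
  moreover have "- b \<le> \<phi>"
  proof (rule ccontr)
    assume "\<not> - b \<le> \<phi>"
    \<comment> \<open>The mirror image, with a rotation by \<open>cis b\<close>. Because
      \<open>- \<psi> \<le> \<beta>\<close>, the bound \<open>q \<le> r\<close> and monotonicity of
      the sine suffice.\<close>
    then have "0 < \<rho> * sin (- \<phi> - b)" using b w by (intro mult_pos_pos sin_gt_zero) auto
    also have "\<rho> * sin (- \<phi> - b) = - (\<rho> * sin \<phi>) * cos b - (\<rho> * cos \<phi>) * sin b"
      by (simp add: sin_diff algebra_simps)
    also have "\<dots> = q * sin (- \<psi> - b) - sin b"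
      unfolding w(4) [symmetric] w(5) [symmetric] by (simp add: sin_diff algebra_simps)
    finally have gt: "sin b < q * sin (- \<psi> - b)" by simp
    have sb: "0 \<le> sin b" using b by (intro sin_ge_zero) auto
    show False
    proof (cases "- \<psi> \<le> b")
      case True
      then have "0 \<le> sin (b + \<psi>)" using \<psi> b by (intro sin_ge_zero) auto
      moreover have "sin (- \<psi> - b) = - sin (b + \<psi>)" using sin_minus [of "b + \<psi>"] by (simp add: algebra_simps)
      ultimately have "q * sin (- \<psi> - b) \<le> 0" using q by (simp only: mult_nonneg_nonpos neg_le_0_iff_le)
      then show False using gt sb by linarith
    next
      case False
      have "q * sin (- \<psi> - b) \<le> r * sin (\<beta> - b)"
        using False \<psi> q \<theta> b r \<beta> by (intro mult_mono sin_ge_zero sin_monotone_2pi_le) auto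
      then show False using gt r by linarith
    qed
  qed
  moreover have "exp (- cot \<theta> * \<phi>) \<le> \<rho>"
  proof (cases "0 \<le> \<phi>")
    case True
    have "0 \<le> cot \<theta>" using \<theta> s\<theta> by (simp add: cot_def cos_ge_zero)
    then have "exp (- cot \<theta> * \<phi>) \<le> 1" using True by simp
    then show ?thesis using \<rho> by linarith
  next
    case False
    define p where "p = - \<phi>"
    \<comment> \<open>Since \<open>- \<theta> \<le> \<psi> \<le> pi / 2\<close>, the point
      \<open>R\<close> lies in the half-plane \<open>x + cot \<theta> * y \<ge> 0\<close>. Hence
      \<open>1 + R\<close> lies on or beyond the tangent to the spiral at 1, and so not inside the
      spiral.\<close>
    have "0 \<le> sin (\<theta> + \<psi>)" using \<psi> \<beta> \<theta> by (intro sin_ge_zero) auto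
    then have "0 \<le> cos \<psi> + cot \<theta> * sin \<psi>"
      using s\<theta> by (simp add: sin_add cot_def field_simps)
    then have "1 \<le> 1 + q * (cos \<psi> + cot \<theta> * sin \<psi>)" using q by simp
    also have "\<dots> = \<rho> * cos \<phi> + cot \<theta> * (\<rho> * sin \<phi>)"
      unfolding w(4) [symmetric] w(5) [symmetric] by (simp add: algebra_simps)
    also have "\<dots> = \<rho> * (cos p - cot \<theta> * sin p)" by (simp add: p_def algebra_simps)
    finally have "exp (cot \<theta> * p) * 1 \<le> exp (cot \<theta> * p) * (\<rho> * (cos p - cot \<theta> * sin p))"
      by (intro mult_left_mono) auto
    also have "\<dots> = \<rho> * (exp (cot \<theta> * p) * (cos p - cot \<theta> * sin p))" by simp
    also have "\<dots> \<le> \<rho> * 1"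
      using w False by (intro mult_left_mono exp_mult_cos_minus_sin_le) (auto simp: p_def)
    finally show ?thesis by (simp add: p_def)
  qed
  ultimately show "1 + R \<in> region (cot \<theta>) a b"
    unfolding region_def using w \<rho> by blast
qed

end


section \<open>Ratios of independence polynomials\<close>

definition nbh :: "'a set set \<Rightarrow> 'a \<Rightarrow> 'a set" where
  "nbh E v = {u. {v, u} \<in> E}"

lemma nbh_sym: "u \<in> nbh E v \<longleftrightarrow> v \<in> nbh E u"
  by (simp add: nbh_def insert_commute)

text \<open>Distinct neighbours \<open>u\<close> of \<open>v\<close> give distinct edges
  \<open>{v, u}\<close>.\<close>

lemma card_nbh_le_degree:
  assumes "finite E"
  shows "finite (nbh E v)" "card (nbh E v) \<le> degree E v"
proof -
  have inj: "inj_on (\<lambda>u. {v, u}) (nbh E v)" by (auto simp: inj_on_def doubleton_eq_iff)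
  have sub: "(\<lambda>u. {v, u}) ` nbh E v \<subseteq> {e \<in> E. v \<in> e}" by (auto simp: nbh_def)
  have "finite {e \<in> E. v \<in> e}" using assms by simp
  then have "finite ((\<lambda>u. {v, u}) ` nbh E v)" using sub by (rule finite_subset [rotated])
  then show "finite (nbh E v)" using inj by (rule finite_imageD)
  show "card (nbh E v) \<le> degree E v"
    unfolding degree_def using assms by (intro card_inj_on_le [OF inj sub]) auto
qed

lemma indep_insert:
  assumes "v \<notin> I"
  shows "indep (insert v I) E \<longleftrightarrow> indep I E \<and> I \<inter> nbh E v = {}"
  using assms by (auto simp: indep_def nbh_def insert_commute)

lemma indep_poly_empty [simp]: "indep_poly {} E z = 1"
proof -
  have "{I. I \<subseteq> {} \<and> indep I E} = {{}}" by auto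
  then show ?thesis by (simp add: indep_poly_def)
qed

text \<open>Sort the independent sets by whether they contain \<open>v\<close>; those that do are
  \<open>insert v J\<close> with \<open>J\<close> independent and disjoint from the neighbourhood of
  \<open>v\<close>.\<close>

lemma indep_poly_insert:
  assumes "finite U" "v \<notin> U"
  shows "indep_poly (insert v U) E z = indep_poly U E z + z * indep_poly (U - nbh E v) E z"
proof -
  let ?A = "{I. I \<subseteq> U \<and> indep I E}" and ?B = "{I. I \<subseteq> U - nbh E v \<and> indep I E}"
  have eq: "{I. I \<subseteq> insert v U \<and> indep I E} = ?A \<union> insert v ` ?B"
  proof (intro equalityI subsetI)
    fix I assume I: "I \<in> {I. I \<subseteq> insert v U \<and> indep I E}"
    show "I \<in> ?A \<union> insert v ` ?B"
    proof (cases "v \<in> I")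
      case True
      then have J: "I = insert v (I - {v})" by auto
      then have "indep (I - {v}) E \<and> (I - {v}) \<inter> nbh E v = {}"
        using I indep_insert [of v "I - {v}" E] by auto
      then have "I - {v} \<in> ?B" using I by auto
      then show ?thesis using J by blast
    qed (use I in auto)
  next
    fix I assume "I \<in> ?A \<union> insert v ` ?B"
    then show "I \<in> {I. I \<subseteq> insert v U \<and> indep I E}"
    proof
      assume "I \<in> insert v ` ?B"
      then obtain J where J: "I = insert v J" "J \<subseteq> U - nbh E v" "indep J E" by auto
      then show ?thesis using assms indep_insert [of v J E] by auto
    qed auto
  qed
  have fin: "finite ?A" "finite ?B" using assms by auto
  have inj: "inj_on (insert v) ?B"
    using assms by (intro inj_onI) (metis (no_types, lifting) CollectD DiffD1 insert_ident subset_iff)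
  have "indep_poly (insert v U) E z = (\<Sum>I\<in>?A. z ^ card I) + (\<Sum>I\<in>insert v ` ?B. z ^ card I)"
    unfolding indep_poly_def eq using fin assms by (intro sum.union_disjoint) auto
  also have "(\<Sum>I\<in>insert v ` ?B. z ^ card I) = (\<Sum>I\<in>?B. z ^ card (insert v I))"
    by (simp add: sum.reindex [OF inj])
  also have "\<dots> = (\<Sum>I\<in>?B. z * z ^ card I)"
  proof (rule sum.cong [OF refl])
    fix I assume "I \<in> ?B"
    then have "finite I" "v \<notin> I" using assms by (auto intro: finite_subset)
    then show "z ^ card (insert v I) = z * z ^ card I" by simp
  qed
  finally show ?thesis by (simp add: indep_poly_def sum_distrib_left)
qed

section \<open>Induction over induced subgraphs\<close>

locale admissible_graph = admissible "real d" \<theta> \<beta> a b r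
  for d :: nat and \<theta> \<beta> a b r :: real +
  fixes V :: "'a set" and E :: "'a set set"
  assumes fin: "finite V" and nbh_card: "\<And>v. v \<in> V \<Longrightarrow> finite (nbh E v) \<and> card (nbh E v) \<le> d + 1"
begin

text \<open>Every subgraph in the induction is an induced one, so the vertex set alone varies and
  \<open>E\<close> stays fixed.\<close>

abbreviation Z :: "'a set \<Rightarrow> complex" where
  "Z U \<equiv> indep_poly U E (complex_of_real r * cis \<theta>)"

text \<open>The ratio clause is restricted to at most \<open>d\<close> neighbours because the ratio
  is \<open>1 + z / P\<close> and the one-step estimate allows at most \<open>d\<close> factors in
  \<open>P\<close>.\<close>

definition good :: "'a set \<Rightarrow> bool" where
  "good U \<longleftrightarrow> Z U \<noteq> 0 \<and>
    (\<forall>v\<in>V - U. card (nbh E v \<inter> U) \<le> d \<longrightarrow> Z (insert v U) / Z U \<in> region (cot \<theta>) a b)"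

text \<open>This is the drop from \<open>d + 1\<close> to \<open>d\<close>: the neighbour
  \<open>v\<close> of \<open>u\<close> lies outside \<open>U\<close>.\<close>

lemma card_nbh_Int_le:
  assumes "u \<in> V" "v \<in> nbh E u" "v \<notin> U"
  shows "card (nbh E u \<inter> U) \<le> d"
proof -
  have "card (nbh E u \<inter> U) < card (nbh E u)"
    using nbh_card [OF assms(1)] assms by (intro psubset_card_mono) auto
  then show ?thesis using nbh_card [OF assms(1)] by linarith
qed

text \<open>
  Adding the vertices of \<open>S\<close> one at a time, each has at most \<open>d\<close> neighbours among those already
  present, since its neighbour \<open>v\<close> is missing.
\<close>

lemma telescope:
  assumes "finite S" "S \<subseteq> nbh E v" "v \<notin> B" "v \<notin> S" "S \<inter> B = {}" "B \<union> S \<subseteq> V"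
    and "\<And>W. W \<subseteq> B \<union> S \<Longrightarrow> W \<noteq> B \<union> S \<Longrightarrow> good W"
    and "Z B \<noteq> 0"
  shows "Z (B \<union> S) / Z B \<in> region (cot \<theta>) (real (card S) * a) (real (card S) * b)"
  using assms
proof (induction S rule: finite_induct)
  case empty
  then show ?case by (simp add: one_in_region)
next
  case (insert u S)
  have good: "good (B \<union> S)" using insert by (intro insert.prems(6)) auto
  have "Z (B \<union> S) / Z B \<in> region (cot \<theta>) (real (card S) * a) (real (card S) * b)"
    using insert.prems insert.hyps by (intro insert.IH) (auto intro!: insert.prems(6))
  moreover have "Z (insert u (B \<union> S)) / Z (B \<union> S) \<in> region (cot \<theta>) a b"
    using good insert.prems insert.hyps nbh_sym [of u E v] card_nbh_Int_le [of u v "B \<union> S"]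
    unfolding good_def by auto
  ultimately have "Z (insert u (B \<union> S)) / Z (B \<union> S) * (Z (B \<union> S) / Z B)
      \<in> region (cot \<theta>) (a + real (card S) * a) (b + real (card S) * b)"
    by (rule region_mult [rotated])
  then show ?case
    using insert.hyps good by (simp add: good_def algebra_simps)
qed

text \<open>Induction on proper subsets. Nonvanishing of \<open>Z U\<close> comes first, from ratios
  on smaller sets; the ratio clause at \<open>U\<close> then divides by \<open>Z U\<close>.\<close>

lemma all_good:
  assumes "U \<subseteq> V"
  shows "good U"
proof -
  have "finite U" using assms fin finite_subset by blast
  then show ?thesis using assms
  proof (induction U rule: finite_psubset_induct)
    case (psubset U)
    have IH: "good W" if "W \<subset> U" for W using psubset that by blast
    have ZU: "Z U \<noteq> 0"
    proof (cases "U = {}")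
      case False
      then obtain v where v: "v \<in> U" by blast
      define U' where "U' = U - {v}"
      have U: "U = insert v U'" "v \<notin> U'" "finite U'" "v \<in> V"
        using v psubset by (auto simp: U'_def)
      have good: "good U'" using U by (intro IH) auto
      show ?thesis
      proof (cases "card (nbh E v \<inter> U') \<le> d")
        case True
        then have "Z U / Z U' \<in> region (cot \<theta>) a b" using good U by (auto simp: good_def)
        then have "0 < Re (Z U / Z U')" using a b by (intro region_Re_pos [of _ "cot \<theta>" a b]) auto
        then show ?thesis by auto
      next
        case False
        \<comment> \<open>All \<open>d + 1\<close> neighbours of \<open>v\<close> are present, one
          too many for the ratio clause. One of them, \<open>u\<close>, is set aside: the other
          \<open>d\<close> yield \<open>P\<close>, and \<open>u\<close> contributes a ratio
          \<open>w\<close> of its own, allowed because its neighbour \<open>v\<close> is absent from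
          \<open>B \<union> S\<close>.\<close>
        then have "card (nbh E v \<inter> U') = Suc d"
          using nbh_card [OF U(4)] card_mono [of "nbh E v" "nbh E v \<inter> U'"] by fastforce
        then obtain u S where S: "nbh E v \<inter> U' = insert u S" "u \<notin> S" "card S = d" "finite S"
          by (metis card_Suc_eq_finite)
        define B where "B = U' - nbh E v"
        have B: "U' = insert u (B \<union> S)" "u \<notin> B \<union> S" "S \<inter> B = {}" using S by (auto simp: B_def)
        have gB: "good B" and gBS: "good (B \<union> S)" using U B by (auto intro!: IH)
        have sub: "B \<union> S \<subset> U" "B \<union> S \<subseteq> V" "v \<notin> B \<union> S" "u \<in> nbh E v" "S \<subseteq> nbh E v" "u \<in> V"
          using U B S psubset.prems by auto
        have nz: "Z B \<noteq> 0" "Z (B \<union> S) \<noteq> 0" using gB gBS by (auto simp: good_def)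
        define P where "P = Z (B \<union> S) / Z B"
        define w where "w = Z U' / Z (B \<union> S)"
        have "P \<in> region (cot \<theta>) (real (card S) * a) (real (card S) * b)"
          unfolding P_def
        proof (rule telescope [where v = v])
          fix W assume "W \<subseteq> B \<union> S"
          then show "good W" using sub(1) by (intro IH) blast
        qed (use S(4) sub B(3) nz in auto)
        then have P: "P \<in> region (cot \<theta>) (real d * a) (real d * b)" using S(3) by simp
        have "card (nbh E u \<inter> (B \<union> S)) \<le> d"
          using sub nbh_sym [of u E v] by (intro card_nbh_Int_le [of u v]) auto
        then have "w \<in> region (cot \<theta>) a b"
          using gBS B(2) sub(6) unfolding good_def w_def B(1) by blast
        then have w: "0 < Re w" using a b by (intro region_Re_pos [of _ "cot \<theta>" a b]) auto
        \<comment> \<open>With \<open>Z (B \<union> S)\<close> taken out, the two summands have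
          positive and nonnegative real part, so they cannot cancel.\<close>
        have "Z U = Z U' + complex_of_real r * cis \<theta> * Z B"
          unfolding U(1) B_def using U by (intro indep_poly_insert) auto
        also have "\<dots> = Z (B \<union> S) * (w + complex_of_real r * cis \<theta> / P)"
          using nz by (simp add: w_def P_def field_simps)
        finally have "Z U = Z (B \<union> S) * (w + complex_of_real r * cis \<theta> / P)" .
        moreover have "0 < Re (w + complex_of_real r * cis \<theta> / P)"
          using w ratio_in_region(1) [OF P] by simp
        then have "w + complex_of_real r * cis \<theta> / P \<noteq> 0" by (metis less_irrefl zero_complex.sel(1))
        ultimately show ?thesis using nz by simp
      qed
    qed simp
    have "Z (insert v U) / Z U \<in> region (cot \<theta>) a b" if v: "v \<in> V - U" "card (nbh E v \<inter> U) \<le> d" for v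
    proof -
      define S B where "S = nbh E v \<inter> U" and "B = U - nbh E v"
      have U: "U = B \<union> S" "S \<inter> B = {}" by (auto simp: S_def B_def)
      \<comment> \<open>If \<open>v\<close> has no neighbour in \<open>U\<close>, then
        \<open>B = U\<close> is outside the induction hypothesis, and the nonvanishing just shown is
        used instead.\<close>
      have ZB: "Z B \<noteq> 0"
        using ZU IH [of B] by (cases "B = U") (auto simp: good_def B_def)
      have "Z U / Z B \<in> region (cot \<theta>) (real (card S) * a) (real (card S) * b)"
        unfolding U(1)
      proof (rule telescope [where v = v])
        show "B \<union> S \<subseteq> V" using U(1) psubset.prems by simp
        show "finite S" using psubset.hyps by (simp add: S_def)
        \<comment> \<open>\<open>good U\<close> is still being proved; only proper subsets of
          \<open>B \<union> S = U\<close> are asked for.\<close>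
        show "good W" if "W \<subseteq> B \<union> S" "W \<noteq> B \<union> S" for W
          using that U(1) by (intro IH) blast
      qed (use v U(2) ZB in \<open>auto simp: S_def B_def\<close>)
      \<comment> \<open>With fewer than \<open>d\<close> neighbours the sector is widened to the
        full one, as \<open>a\<close> and \<open>b\<close> are nonnegative.\<close>
      moreover have "real (card S) * a \<le> real d * a" "real (card S) * b \<le> real d * b"
        using v(2) a(1) b(1) by (auto simp: S_def intro!: mult_right_mono)
      ultimately have "Z U / Z B \<in> region (cot \<theta>) (real d * a) (real d * b)"
        using region_mono by blast
      then have "1 + complex_of_real r * cis \<theta> / (Z U / Z B) \<in> region (cot \<theta>) a b"
        by (rule ratio_in_region(2))
      also have "1 + complex_of_real r * cis \<theta> / (Z U / Z B) = Z (insert v U) / Z U"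
        using v psubset ZU ZB by (simp add: indep_poly_insert B_def field_simps)
      finally show ?thesis .
    qed
    then show ?case using ZU by (simp add: good_def)
  qed
qed

end

section \<open>The critical angles\<close>

text \<open>The difference \<open>cot x - cot y\<close> is
  \<open>sin (y - x) / (sin x * sin y)\<close>.\<close>

lemma cot_strict_antimono:
  fixes x y :: real
  assumes "0 < x" "x < y" "y < pi"
  shows "cot y < cot x"
proof -
  have "0 < sin (y - x)" "0 < sin x" "0 < sin y" using assms by (auto intro!: sin_gt_zero)
  then show ?thesis by (simp add: cot_def sin_diff divide_simps algebra_simps)
qed

lemma divide_less_of_double:
  fixes x c D :: real
  assumes "0 \<le> x" "x < 2 * c" "2 \<le> D"
  shows "x / D < c"
proof -
  have "x / D \<le> x / 2" using assms by (intro divide_left_mono) auto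
  also have "\<dots> < c" using assms by simp
  finally show ?thesis .
qed

section \<open>The critical angle\<close>

text \<open>The equation defining \<open>theta_crit d\<close> is \<open>crit_fun d x = 0\<close>.\<close>

definition crit_fun :: "nat \<Rightarrow> real \<Rightarrow> real" where
  "crit_fun d x = cot ((pi / 2 - x) / real d) - cot x - cot (2 * x / real d)"

lemma crit_fun_strict_mono:
  assumes "2 \<le> d" "0 < x" "x < y" "y < pi / 2"
  shows "crit_fun d x < crit_fun d y"
proof -
  have d: "2 \<le> real d" using assms by simp
  have "cot y < cot x" using assms by (intro cot_strict_antimono) auto
  moreover have "cot ((pi / 2 - x) / real d) < cot ((pi / 2 - y) / real d)"
  proof (intro cot_strict_antimono)
    show "(pi / 2 - x) / real d < pi"
      using assms d by (intro divide_less_of_double) auto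
  qed (use assms d in \<open>auto simp: divide_strict_right_mono\<close>)
  moreover have "cot (2 * y / real d) < cot (2 * x / real d)"
  proof (intro cot_strict_antimono)
    show "2 * y / real d < pi"
      using assms d by (intro divide_less_of_double) auto
  qed (use assms d in \<open>auto simp: divide_strict_right_mono\<close>)
  ultimately show ?thesis unfolding crit_fun_def by linarith
qed

text \<open>Take reciprocals of both sides. The lower bound on \<open>x\<close> says exactly that
  \<open>(pi / 2 - x) / d < x\<close>, which makes the denominator positive.\<close>

lemma theta_crit_eq_iff:
  assumes "2 \<le> d" "pi / (2 * (real d + 1)) < x" "x < pi / 2"
  shows "tan (2 * x / real d) = tan ((pi / 2 - x) / real d) / (1 - tan ((pi / 2 - x) / real d) / tan x)
    \<longleftrightarrow> crit_fun d x = 0"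
proof -
  define b where "b = (pi / 2 - x) / real d"
  have d: "2 \<le> real d" using assms by simp
  have x: "0 < x" using assms(2) d by (smt (verit, best) divide_pos_pos pi_gt_zero)
  have "0 < b" using assms d by (simp add: b_def)
  moreover have "b < x" using assms(2) d by (simp add: b_def field_simps)
  ultimately have "0 < tan b" "tan b < tan x"
    using assms by (auto intro!: tan_gt_zero tan_monotone)
  moreover have "2 * x / real d < pi / 2"
    using assms d x by (intro divide_less_of_double) auto
  then have "0 < tan (2 * x / real d)" using x d by (intro tan_gt_zero) auto
  ultimately show ?thesis
    unfolding crit_fun_def b_def [symmetric] cot_altdef by (auto simp: field_simps)
qed

text \<open>The intermediate value theorem gives a zero of \<open>crit_fun d\<close> up to
  \<open>pi / 4\<close>, and strict monotonicity makes it unique, so the definite description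
  denotes it.\<close>

lemma theta_crit_props:
  assumes "2 \<le> d"
  shows "0 < theta_crit d" "theta_crit d < pi / 2" "crit_fun d (theta_crit d) = 0"
proof -
  have d: "2 \<le> real d" using assms by simp
  define l where "l = pi / (2 * (real d + 1))"
  have "pi / (2 * (real d + 1)) < pi / 4"
    using d by (intro divide_strict_left_mono) auto
  then have l: "0 < l" "l < pi / 4" using d by (auto simp: l_def)
  \<comment> \<open>At \<open>l\<close> the first two cotangents have equal arguments and
    cancel.\<close>
  have "crit_fun d l < 0"
  proof -
    have "(2 * (real d + 1)) * l = pi" using d by (simp add: l_def)
    then have "(pi / 2 - l) / real d = l" using d by (simp add: field_simps)
    moreover have "2 * l / real d \<le> l" using d l by (simp add: field_simps)
    then have "0 < cot (2 * l / real d)" using d l by (intro cot_gt_zero) auto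
    ultimately show ?thesis by (simp add: crit_fun_def)
  qed
  \<comment> \<open>At \<open>pi / 4\<close> the double-angle formula turns the value into a square
    over \<open>2 * tan c\<close>.\<close>
  moreover have "0 \<le> crit_fun d (pi / 4)"
  proof -
    define c where "c = pi / (4 * real d)"
    have c: "0 < c" "c < pi / 4" "2 * c < pi / 2" using d by (auto simp: c_def field_simps)
    have t: "0 < tan c" "tan c < 1"
      using c tan_gt_zero [of c] tan_monotone [of c "pi / 4"] by (auto simp: tan_45)
    have e: "(pi / 2 - pi / 4) / real d = c" "2 * (pi / 4) / real d = 2 * c"
      using d by (auto simp: c_def field_simps)
    have cc: "cos c \<noteq> 0" "cos (2 * c) \<noteq> 0"
      using c cos_gt_zero_pi [of c] cos_gt_zero_pi [of "2 * c"] by auto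
    have "crit_fun d (pi / 4) = 1 / tan c - 1 - (1 - (tan c)\<^sup>2) / (2 * tan c)"
      unfolding crit_fun_def e by (simp add: cot_altdef tan_45 tan_double [OF cc] inverse_eq_divide)
    also have "\<dots> = (1 - tan c)\<^sup>2 / (2 * tan c)"
      using t by (simp add: field_simps power2_eq_square)
    finally show ?thesis using t by simp
  qed
  moreover have "continuous_on {l..pi / 4} (crit_fun d)"
  proof -
    have "sin ((pi / 2 - x) / real d) \<noteq> 0 \<and> sin x \<noteq> 0 \<and> sin (2 * x / real d) \<noteq> 0"
      if "x \<in> {l..pi / 4}" for x
    proof -
      have x: "0 < x" "x \<le> pi / 4" using that l by auto
      have "0 < sin ((pi / 2 - x) / real d)"
      proof (rule sin_gt_zero)
        show "(pi / 2 - x) / real d < pi"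
          using x d by (intro divide_less_of_double) auto
      qed (use x d in auto)
      moreover have "0 < sin x" using x by (intro sin_gt_zero) auto
      moreover have "0 < sin (2 * x / real d)"
      proof (rule sin_gt_zero)
        show "2 * x / real d < pi"
          using x d by (intro divide_less_of_double) auto
      qed (use x d in auto)
      ultimately show ?thesis by simp
    qed
    then show ?thesis unfolding crit_fun_def using d by (intro continuous_intros) auto
  qed
  ultimately obtain x where x: "l \<le> x" "x \<le> pi / 4" "crit_fun d x = 0"
    using IVT' [of "crit_fun d" l 0 "pi / 4"] l by auto
  then have "l < x" using \<open>crit_fun d l < 0\<close> by (cases "l = x") auto
  let ?P = "\<lambda>x. l < x \<and> x < pi / 2 \<and>
     tan (2 * x / real d) = tan ((pi / 2 - x) / real d) / (1 - tan ((pi / 2 - x) / real d) / tan x)"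
  have Px: "?P x"
  proof -
    have "x < pi / 2" using x(2) pi_gt_zero by linarith
    then show ?thesis
      using x(3) \<open>l < x\<close> theta_crit_eq_iff [OF assms, of x] unfolding l_def by blast
  qed
  have "theta_crit d = x"
    unfolding theta_crit_def l_def [symmetric]
  proof (rule the_equality)
    show "?P x" by (fact Px)
  next
    fix y assume y: "?P y"
    then have "crit_fun d y = 0" using theta_crit_eq_iff [OF assms, of y] unfolding l_def by auto
    then show "y = x"
      using crit_fun_strict_mono [OF assms, of x y] crit_fun_strict_mono [OF assms, of y x] x y Px l
      by (cases x y rule: linorder_cases) auto
  qed
  then show "0 < theta_crit d" "theta_crit d < pi / 2" "crit_fun d (theta_crit d) = 0"
    using x l pi_gt_zero by auto
qed

lemma crit_fun_sign:
  assumes "2 \<le> d" "0 < \<theta>" "\<theta> < pi / 2"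
  shows "crit_fun d \<theta> \<le> 0 \<longleftrightarrow> \<theta> \<le> theta_crit d"
  using crit_fun_strict_mono [OF assms(1), of \<theta> "theta_crit d"]
    crit_fun_strict_mono [OF assms(1), of "theta_crit d" \<theta>]
    theta_crit_props [OF assms(1)] assms
  by (cases \<theta> "theta_crit d" rule: linorder_cases) auto

section \<open>The angle \<open>beta_star\<close>\<close>

text \<open>The equation defining \<open>beta_star d \<theta>\<close> is \<open>beta_fun d \<theta> x = 0\<close>.\<close>

definition beta_fun :: "nat \<Rightarrow> real \<Rightarrow> real \<Rightarrow> real" where
  "beta_fun d \<theta> x = sin (x - (pi / 2 - \<theta>) / real d)
     - sin ((pi / 2 - \<theta>) / real d) * sin \<theta> * cot ((\<theta> + x) / real d)"

text \<open>The prefactor is positive, so the sign of \<open>beta_fun\<close> at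
  \<open>x = \<theta>\<close> tells on which side of \<open>theta_crit d\<close> the angle
  \<open>\<theta>\<close> lies.\<close>

lemma beta_fun_diagonal:
  assumes "2 \<le> d" "0 < \<theta>" "\<theta> < pi / 2"
  shows "beta_fun d \<theta> \<theta> = sin ((pi / 2 - \<theta>) / real d) * sin \<theta> * crit_fun d \<theta>"
proof -
  define b where "b = (pi / 2 - \<theta>) / real d"
  have d: "2 \<le> real d" using assms by simp
  have "b < pi" unfolding b_def using assms d by (intro divide_less_of_double) auto
  then have "0 < sin b" "0 < sin \<theta>" using assms d by (auto intro!: sin_gt_zero simp: b_def)
  then have "sin (\<theta> - b) = sin b * sin \<theta> * (cot b - cot \<theta>)"
    by (simp add: sin_diff cot_def field_simps)
  then show ?thesis
    unfolding beta_fun_def crit_fun_def b_def [symmetric] by (simp add: algebra_simps)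
qed

text \<open>\<open>beta_fun d \<theta>\<close> increases strictly from a negative value at 0 to a
  value at \<open>\<theta>\<close> that is positive because \<open>\<theta>\<close> exceeds
  \<open>theta_crit d\<close>.\<close>

lemma beta_star_props:
  assumes "2 \<le> d" "theta_crit d < \<theta>" "\<theta> < pi / 2"
  shows "0 < beta_star d \<theta>" "beta_star d \<theta> < \<theta>" "beta_fun d \<theta> (beta_star d \<theta>) = 0"
proof -
  have d: "2 \<le> real d" using assms by simp
  have \<theta>: "0 < \<theta>" "\<theta> < pi / 2" using assms theta_crit_props [OF assms(1)] by auto
  define b where "b = (pi / 2 - \<theta>) / real d"
  have b: "0 < b" "b < pi / 2"
    unfolding b_def using \<theta> d divide_less_of_double [of "pi / 2 - \<theta>" "pi / 2" "real d"] by auto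
  have sb: "0 < sin b" "0 < cos b" "0 < sin \<theta>" "0 < tan b"
    using b \<theta> by (auto intro!: sin_gt_zero cos_gt_zero tan_gt_zero)
  have arg: "0 < (\<theta> + x) / real d" "(\<theta> + x) / real d < pi / 2" if "0 \<le> x" "x \<le> \<theta>" for x
    using that \<theta> d divide_less_of_double [of "\<theta> + x" "pi / 2" "real d"] by auto
  have mono: "beta_fun d \<theta> x < beta_fun d \<theta> y" if "0 \<le> x" "x < y" "y \<le> \<theta>" for x y
  proof -
    have "sin (x - b) < sin (y - b)"
      using that b \<theta> by (intro sin_monotone_2pi) auto
    moreover have "cot ((\<theta> + y) / real d) < cot ((\<theta> + x) / real d)"
      using that arg(1) [of x] order_less_trans [OF arg(2) [of y]] d
      by (intro cot_strict_antimono) (auto intro!: divide_strict_right_mono)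
    then have "sin b * sin \<theta> * cot ((\<theta> + y) / real d) < sin b * sin \<theta> * cot ((\<theta> + x) / real d)"
      using sb by simp
    ultimately show ?thesis unfolding beta_fun_def b_def [symmetric] by linarith
  qed
  have eq: "tan ((\<theta> + x) / real d) / sin \<theta> = tan b / (sin x - cos x * tan b)
      \<longleftrightarrow> beta_fun d \<theta> x = 0" if "0 \<le> x" "x \<le> \<theta>" for x
  proof -
    have t: "0 < tan ((\<theta> + x) / real d)" using arg [OF that] by (intro tan_gt_zero)
    have den: "sin x - cos x * tan b = sin (x - b) / cos b"
      using sb by (simp add: sin_diff tan_def field_simps)
    have "tan b / (sin (x - b) / cos b) = sin b / sin (x - b)"
      using sb by (simp add: tan_def)
    \<comment> \<open>At \<open>s = 0\<close> both sides are false: \<open>B / 0 = 0\<close> differs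
      from \<open>T / S\<close>, and \<open>B * S / T\<close> is positive. So
      \<open>sin (x - b)\<close> may have any sign.\<close>
    moreover have "T / S = B / s \<longleftrightarrow> s - B * S * inverse T = 0"
      if "0 < T" "0 < S" "0 < B" for T S B s :: real
      using that by (cases "s = 0") (auto simp: field_simps)
    ultimately show ?thesis
      unfolding den beta_fun_def b_def [symmetric] cot_altdef using t sb by metis
  qed
  have "0 < sin b * sin \<theta> * cot (\<theta> / real d)"
    using sb arg [of 0] \<theta> cot_gt_zero [of "\<theta> / real d"] by simp
  then have "beta_fun d \<theta> 0 < 0"
    using sb(1) unfolding beta_fun_def b_def [symmetric] by (simp del: mult_less_0_iff zero_less_mult_iff)
  moreover have "0 < beta_fun d \<theta> \<theta>"
    using beta_fun_diagonal [OF assms(1) \<theta>] crit_fun_sign [OF assms(1) \<theta>] assms(2) sb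
    unfolding b_def by simp
  moreover have "continuous_on {0..\<theta>} (beta_fun d \<theta>)"
  proof -
    have "sin ((\<theta> + x) / real d) \<noteq> 0" if "x \<in> {0..\<theta>}" for x
      using arg [of x] that sin_gt_zero2 [of "(\<theta> + x) / real d"] by auto
    then show ?thesis unfolding beta_fun_def using d by (intro continuous_intros) auto
  qed
  ultimately obtain x where x: "0 \<le> x" "x \<le> \<theta>" "beta_fun d \<theta> x = 0"
    using IVT' [of "beta_fun d \<theta>" 0 0 \<theta>] \<theta> by auto
  have x': "0 < x" "x < \<theta>"
    using x \<open>beta_fun d \<theta> 0 < 0\<close> \<open>0 < beta_fun d \<theta> \<theta>\<close> by (metis less_irrefl order_less_le)+
  let ?P = "\<lambda>x. 0 < x \<and> x < \<theta> \<and>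
    tan ((\<theta> + x) / real d) / sin \<theta> = tan b / (sin x - cos x * tan b)"
  have Px: "?P x" using x x' eq by auto
  have "(THE x. ?P x) = x"
  proof (rule the_equality)
    show "?P x" by (fact Px)
  next
    fix y assume y: "?P y"
    then have "beta_fun d \<theta> y = 0" using eq [of y] by auto
    then show "y = x"
      using mono [of x y] mono [of y x] x y Px by (cases x y rule: linorder_cases) auto
  qed
  then have "beta_star d \<theta> = x" using \<theta> by (simp add: beta_star_def b_def)
  then show "0 < beta_star d \<theta>" "beta_star d \<theta> < \<theta>" "beta_fun d \<theta> (beta_star d \<theta>) = 0"
    using x x' by auto
qed

section \<open>From the radius bound to the parameters of the region\<close>

text \<open>The choice of \<open>\<beta>\<close> makes
  \<open>r1 d \<theta> = tan a / sin \<theta>\<close> in both branches, which is the upper angle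
  condition. For \<open>\<theta> < pi / 2\<close> the lower one follows from
  \<open>beta_fun d \<theta> \<beta> \<le> 0\<close>, that is,
  \<open>sin (\<beta> - b) \<le> sin b * sin \<theta> * cot a\<close>.\<close>

lemma r1_admissible:
  assumes "2 \<le> d" "0 < \<theta>" "\<theta> \<le> pi / 2" "0 \<le> r" "r \<le> r1 d \<theta>"
  obtains \<beta> where "admissible (real d) \<theta> \<beta> ((\<theta> + \<beta>) / real d) ((pi / 2 - \<theta>) / real d) r"
proof -
  have d: "2 \<le> real d" using assms by simp
  define \<beta> where "\<beta> = (if \<theta> \<le> theta_crit d then \<theta> else beta_star d \<theta>)"
  define a b where "a = (\<theta> + \<beta>) / real d" and "b = (pi / 2 - \<theta>) / real d"
  have \<beta>: "0 \<le> \<beta>" "\<beta> \<le> \<theta>" "\<theta> + \<beta> < pi" "\<theta> < pi / 2 \<Longrightarrow> beta_fun d \<theta> \<beta> \<le> 0"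
    "\<theta> = pi / 2 \<Longrightarrow> \<beta> = 0"
  proof -
    have "0 \<le> \<beta> \<and> \<beta> \<le> \<theta> \<and> \<theta> + \<beta> < pi \<and> (\<theta> < pi / 2 \<longrightarrow> beta_fun d \<theta> \<beta> \<le> 0) \<and> (\<theta> = pi / 2 \<longrightarrow> \<beta> = 0)"
    proof (cases "\<theta> = pi / 2")
      case True
      then show ?thesis using theta_crit_props [OF assms(1)] by (simp add: \<beta>_def beta_star_def)
    next
      case False
      then have lt: "\<theta> < pi / 2" using assms by simp
      show ?thesis
      proof (cases "\<theta> \<le> theta_crit d")
        case True
        have "0 \<le> sin ((pi / 2 - \<theta>) / real d) * sin \<theta>"
          using lt assms d divide_less_of_double [of "pi / 2 - \<theta>" pi "real d"]
          by (intro mult_nonneg_nonneg sin_ge_zero) auto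
        then have "beta_fun d \<theta> \<theta> \<le> 0"
          using beta_fun_diagonal [OF assms(1,2) lt] crit_fun_sign [OF assms(1,2) lt] True
          by (simp add: mult_nonneg_nonpos)
        then show ?thesis using True lt assms by (simp add: \<beta>_def)
      next
        case False
        then show ?thesis using beta_star_props [OF assms(1) _ lt] lt by (simp add: \<beta>_def)
      qed
    qed
    then show "0 \<le> \<beta>" "\<beta> \<le> \<theta>" "\<theta> + \<beta> < pi" "\<theta> < pi / 2 \<Longrightarrow> beta_fun d \<theta> \<beta> \<le> 0"
      "\<theta> = pi / 2 \<Longrightarrow> \<beta> = 0" by auto
  qed
  have a: "0 < a" "a \<le> \<theta>" "a < pi / 2"
  proof -
    show "0 < a" using assms \<beta> d by (simp add: a_def add_pos_nonneg)
    have "\<theta> + \<beta> \<le> 2 * \<theta>" using \<beta> by simp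
    also have "\<dots> \<le> real d * \<theta>" using assms d by (intro mult_right_mono) auto
    finally show "a \<le> \<theta>" using d by (simp add: a_def field_simps)
    show "a < pi / 2" unfolding a_def using \<beta> assms d by (intro divide_less_of_double) auto
  qed
  have b: "0 \<le> b" "b < pi / 2"
    unfolding b_def using assms d divide_less_of_double [of "pi / 2 - \<theta>" "pi / 2" "real d"] by auto
  have s\<theta>: "0 < sin \<theta>" and ta: "0 < tan a" and ca: "0 < cos a" and sb: "0 \<le> sin b"
    using assms a b by (auto intro!: sin_gt_zero tan_gt_zero cos_gt_zero sin_ge_zero)
  have "r \<le> tan a / sin \<theta>"
    using assms(5) by (auto simp: r1_def a_def \<beta>_def split: if_splits)
  then have ra: "r * sin \<theta> \<le> tan a" using s\<theta> by (simp add: field_simps)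
  have "r * (sin \<theta> * cos a) \<le> sin a"
    using mult_right_mono [OF ra, of "cos a"] ca by (simp add: tan_def mult.assoc)
  moreover have "r * sin (\<beta> - b) \<le> sin b"
  proof (cases "\<theta> = pi / 2")
    case True
    \<comment> \<open>At the right angle the convention \<open>beta_star d \<theta> = 0\<close>
      enters, and both sides vanish.\<close>
    then have "b = 0" "\<beta> = 0" using \<beta>(5) by (simp_all add: b_def)
    then show ?thesis by simp
  next
    case False
    then have "sin (\<beta> - b) \<le> sin b * sin \<theta> * cot a"
      using \<beta> assms unfolding beta_fun_def a_def b_def by simp
    then have "r * sin (\<beta> - b) \<le> r * (sin b * sin \<theta> * cot a)"
      using assms by (intro mult_left_mono)
    also have "\<dots> = (r * sin \<theta>) * (sin b * cot a)" by simp
    also have "\<dots> \<le> tan a * (sin b * cot a)"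
      using ra sb ta by (intro mult_right_mono) (auto simp: cot_altdef)
    also have "\<dots> = sin b" using ta by (simp add: cot_altdef)
    finally show ?thesis .
  qed
  ultimately have "admissible (real d) \<theta> \<beta> a b r"
    using assms \<beta> a b d by unfold_locales (auto simp: a_def b_def)
  then show ?thesis using that by (simp add: a_def b_def)
qed

theorem theorem8p1:
  fixes d :: nat and \<theta> r :: real and z :: complex
    and V :: "'a set" and E :: "'a set set"
  assumes "d \<ge> 2"
    and "0 < \<theta>" and "\<theta> \<le> pi / 2"
    and "0 \<le> r" and "r \<le> r1 d \<theta>"
    and "z = complex_of_real r * exp (\<i> * complex_of_real \<theta>)"
    and "simple_graph V E" and "max_degree_le V E (d + 1)"
  shows "indep_poly V E z \<noteq> 0"
proof -
  obtain \<beta> where "admissible (real d) \<theta> \<beta> ((\<theta> + \<beta>) / real d) ((pi / 2 - \<theta>) / real d) r"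
    using r1_admissible [OF assms(1-5)] .
  then interpret admissible "real d" \<theta> \<beta> "(\<theta> + \<beta>) / real d" "(pi / 2 - \<theta>) / real d" r .
  have "finite V" "finite E"
    using assms(7) finite_imp_finite_nsets [of V 2] by (auto simp: simple_graph_def intro: finite_subset)
  moreover have "finite (nbh E v) \<and> card (nbh E v) \<le> d + 1" if "v \<in> V" for v
    using that assms(8) card_nbh_le_degree [OF \<open>finite E\<close>, of v]
    by (auto simp: max_degree_le_def intro: order_trans)
  ultimately interpret admissible_graph d \<theta> \<beta> "(\<theta> + \<beta>) / real d" "(pi / 2 - \<theta>) / real d" r V E
    by unfold_locales auto
  show ?thesis
    using all_good [of V] by (simp add: good_def assms(6) cis_conv_exp)
qed

end
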